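(* Let $0\le\alpha\le1$ and let $\mathcal{X}=\{x_0,\ldots,x_m\}\subset[-1,1]$ be an increasingly ordered set of distinct nodes, $x_0<x_1<\cdots<x_m$. If the nodes are symmetric with respect to the origin, i.e., $x_i+x_{m-i}=0$ for $i=0,\ldots,m$, then the KTI quadrature weights $w_0^\alpha,\ldots,w_m^\alpha$ satisfy the symmetry relations $$w_i^\alpha=w_{m-i}^\alpha,\qquad i=0,\ldots,m.$$
   Context: The Kosloff Tal-Ezer map $M_\alpha:[-1,1]\to[-1,1]$ is $M_\alpha(x)=\frac{\sin(\alpha\pi x/2)}{\sin(\alpha\pi/2)}$ for $0<\alpha\le1$ and $M_0(x)=x$; it is a strictly increasing bijection of $[-1,1]$. For the mapped nodes $z_i=M_\alpha(x_i)$ let $\ell_i^\alpha(y)=\prod_{0\le j\le m,\ j\ne i}\frac{y-z_j}{z_i-z_j}$ be the Lagrange polynomials. The KTI (interpolatory Kosloff Tal-Ezer) quadrature formula on $\mathcal{X}$ is $f\mapsto\sum_{i=0}^m w_i^\alpha f(x_i)$ with weights $w_i^\alpha=\int_{-1}^1\ell_i^\alpha(M_\alpha(x))\,\mathrm{d}x$. *)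

theory Defs
  imports "HOL-Analysis.Analysis"
begin

definition kt_map :: "real \<Rightarrow> real \<Rightarrow> real" where
  "kt_map \<alpha> x = (if \<alpha> = 0 then x else sin (\<alpha> * pi * x / 2) / sin (\<alpha> * pi / 2))"

(* Nodes are functions on nat of which only the values at 0, ..., m matter. *)

definition mapped_lagrange :: "real \<Rightarrow> nat \<Rightarrow> (nat \<Rightarrow> real) \<Rightarrow> nat \<Rightarrow> real \<Rightarrow> real" where
  "mapped_lagrange \<alpha> m x i y =
     (\<Prod>j\<in>{0..m} - {i}. (y - kt_map \<alpha> (x j)) / (kt_map \<alpha> (x i) - kt_map \<alpha> (x j)))"

(* The integrand is continuous on [-1, 1], so this Henstock-Kurzweil integral
   is the ordinary Riemann integral. *)

definition kti_weight :: "real \<Rightarrow> nat \<Rightarrow> (nat \<Rightarrow> real) \<Rightarrow> nat \<Rightarrow> real" where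
  "kti_weight \<alpha> m x i = integral {-1..1} (\<lambda>t. mapped_lagrange \<alpha> m x i (kt_map \<alpha> t))"

end

theory Submission
  imports Defs
begin

text \<open>
  The Kosloff Tal-Ezer map is odd, so symmetric nodes have symmetric images, and reflecting the
  line about the origin exchanges the \<open>i\<close>-th and the \<open>(m - i)\<close>-th mapped node. Reflection therefore also
  exchanges the Lagrange polynomials that belong to these nodes
  (\<open>mapped_lagrange_reflect\<close>). Composed with the odd map, the two integrands are mirror images of
  each other, and the interval \<open>[-1, 1]\<close> is its own mirror image, so the integrals agree.
\<close>

lemma kt_map_minus: "kt_map \<alpha> (- t) = - kt_map \<alpha> t"
  by (simp add: kt_map_def)

text \<open>
  The index reversal \<open>j \<mapsto> m - j\<close> matches the factors of the two products. Between matched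
  factors both the numerator and the denominator change sign, so the quotients agree.
\<close>

lemma mapped_lagrange_reflect:
  assumes sym: "\<And>j. j \<le> m \<Longrightarrow> x j + x (m - j) = 0" and i: "i \<le> m"
  shows "mapped_lagrange \<alpha> m x (m - i) y = mapped_lagrange \<alpha> m x i (- y)"
proof -
  have image_node: "kt_map \<alpha> (x (m - j)) = - kt_map \<alpha> (x j)" if "j \<le> m" for j
  proof -
    have "x (m - j) = - x j"
      using sym[OF that] by linarith
    then show ?thesis
      by (simp add: kt_map_minus)
  qed
  show ?thesis
    unfolding mapped_lagrange_def
  proof (rule prod.reindex_bij_witness[where i = "\<lambda>j. m - j" and j = "\<lambda>j. m - j"])
    fix j assume "j \<in> {0..m} - {m - i}"
    then have j: "j \<le> m"
      by simp
    have "(- y - - kt_map \<alpha> (x j)) / (kt_map \<alpha> (x i) - - kt_map \<alpha> (x j))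
        = (y - kt_map \<alpha> (x j)) / (- kt_map \<alpha> (x i) - kt_map \<alpha> (x j))"
      using minus_divide_divide[of "y - kt_map \<alpha> (x j)" "- kt_map \<alpha> (x i) - kt_map \<alpha> (x j)"]
      by (simp add: add.commute)
    then show "(- y - kt_map \<alpha> (x (m - j))) / (kt_map \<alpha> (x i) - kt_map \<alpha> (x (m - j)))
        = (y - kt_map \<alpha> (x j)) / (kt_map \<alpha> (x (m - i)) - kt_map \<alpha> (x j))"
      by (simp only: image_node[OF j] image_node[OF i])
  qed (use i in auto)
qed

theorem theorem2:
  fixes \<alpha> :: real and m :: nat and x :: "nat \<Rightarrow> real"
  assumes "0 \<le> \<alpha>" and "\<alpha> \<le> 1"
    and "\<And>i. i \<le> m \<Longrightarrow> x i \<in> {-1..1}"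
    and "strict_mono_on {0..m} x"
    and "\<And>i. i \<le> m \<Longrightarrow> x i + x (m - i) = 0"
  shows "\<forall>i\<in>{0..m}. kti_weight \<alpha> m x i = kti_weight \<alpha> m x (m - i)"
proof
  fix i assume "i \<in> {0..m}"
  then have i: "i \<le> m"
    by simp
  have "kti_weight \<alpha> m x (m - i) = integral {-1..1} (\<lambda>t. mapped_lagrange \<alpha> m x i (kt_map \<alpha> (- t)))"
    by (simp add: kti_weight_def mapped_lagrange_reflect[of m x i, OF assms(5) i] kt_map_minus)
  also have "\<dots> = kti_weight \<alpha> m x i"
    using Henstock_Kurzweil_Integration.integral_reflect_real[of 1 "-1" "\<lambda>t. mapped_lagrange \<alpha> m x i (kt_map \<alpha> t)"]
    by (simp add: kti_weight_def)
  finally show "kti_weight \<alpha> m x i = kti_weight \<alpha> m x (m - i)"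
    by (rule sym)
qed

end
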